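(* $$\sum_{(a,b,c,d)} \frac{1}{(a+c)^2(b+d)^2(a+b+c+d)^2} = \frac13,$$ where the sum runs over all quadruples of non-negative integers $a,b,c,d$ such that $ad-bc=1$. *)

theory Defs
  imports "HOL-Analysis.Infinite_Sum"
begin

end

theory Submission
  imports Defs "HOL-Analysis.Summation_Tests"
begin

text \<open>
  Adding the two rows of a matrix in the sum gives the pair \<open>(x, y) = (a + c, b + d)\<close>, and this is a
  bijection onto the pairs of coprime positive integers (\<open>bij_column_sums\<close>). Therefore the sum
  runs over such pairs, with the term \<open>1 / (x y (x + y))\<^sup>2\<close>.

  It is evaluated with \<open>F x y = 1 / (x y)\<^sup>3\<close>. For \<open>z = x + y\<close>, the identity
  \<open>z\<^sup>3 - x\<^sup>3 - y\<^sup>3 = 3 x y z\<close> says after division by \<open>(x y z)\<^sup>3\<close> that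
  \<open>F x y - F x z - F z y = 3 / (x y z)\<^sup>2\<close> (\<open>inverse_cubes_identity\<close>).
  One subtractive step of Euclid's algorithm shows that every coprime pair other than \<open>(1, 1)\<close>
  has exactly one of the forms \<open>(x, z)\<close> and \<open>(z, y)\<close>, for exactly one coprime pair \<open>(x, y)\<close>.
  Hence, when the identity is summed over all coprime pairs, everything on the left cancels
  except \<open>F 1 1 = 1\<close>. The rearrangement is legitimate because \<open>F\<close> is summable, being at each
  pair a product of terms of two convergent series; so three times the sum is \<open>1\<close>.
\<close>

definition coprime_pairs :: "(nat \<times> nat) set" where
  "coprime_pairs = {(x, y). 0 < x \<and> 0 < y \<and> coprime x y}"

definition F :: "nat \<times> nat \<Rightarrow> real" where
  "F = (\<lambda>(x, y). 1 / (real x ^ 3 * real y ^ 3))"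

lemma inverse_cubes_identity:
  fixes x y :: real
  assumes "x > 0" "y > 0"
  shows "1 / (x ^ 3 * y ^ 3) - 1 / (x ^ 3 * (x + y) ^ 3) - 1 / ((x + y) ^ 3 * y ^ 3)
         = 3 * (1 / (x ^ 2 * y ^ 2 * (x + y) ^ 2))"
proof -
  define z where "z = x + y"
  have "z > 0" using assms by (simp add: z_def)
  have cubes: "z ^ 3 - y ^ 3 - x ^ 3 = 3 * x * y * z"
    unfolding z_def by algebra
  have "1 / (x ^ 3 * y ^ 3) - 1 / (x ^ 3 * z ^ 3) - 1 / (z ^ 3 * y ^ 3)
        = (z ^ 3 - y ^ 3 - x ^ 3) / (x ^ 3 * y ^ 3 * z ^ 3)"
    using assms \<open>z > 0\<close> by (simp add: field_simps)
  also have "\<dots> = 3 * (1 / (x ^ 2 * y ^ 2 * z ^ 2))"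
    unfolding cubes using assms \<open>z > 0\<close> by (simp add: power2_eq_square power3_eq_cube)
  finally show ?thesis by (simp add: z_def)
qed

text \<open>
  \<open>F\<close> is a product of two one-variable functions, so it is summable even over all pairs;
  because \<open>1 / 0 = 0\<close>, the pairs with a zero entry contribute nothing.
\<close>
lemma F_summable: "F summable_on A"
proof -
  have "summable (\<lambda>n. norm (1 / real n ^ 3))"
    using inverse_power_summable[of 3, where 'a = real] by (simp add: inverse_eq_divide)
  then have cubes: "(\<lambda>n. 1 / real n ^ 3) summable_on UNIV"
    by (rule norm_summable_imp_summable_on)
  define s where "s = infsum (\<lambda>n. 1 / real n ^ 3) UNIV"
  have "F summable_on (UNIV \<times> UNIV)"
  proof (rule summable_on_SigmaI)
    show "((\<lambda>y. F (x, y)) has_sum (1 / real x ^ 3 * s)) UNIV" for x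
      using has_sum_cmult_right[OF has_sum_infsum[OF cubes], of "1 / real x ^ 3"]
      by (simp add: F_def s_def)
    show "(\<lambda>x. 1 / real x ^ 3 * s) summable_on UNIV"
      by (rule summable_on_cmult_left[OF cubes])
  qed (simp add: F_def)
  then show ?thesis
    by (rule summable_on_subset_banach) simp
qed

lemma coprime_diff_right_nat:
  fixes x y :: nat
  assumes "x < y"
  shows "coprime x (y - x) \<longleftrightarrow> coprime x y"
  using gcd_diff1_nat[of x y] assms by (simp add: coprime_iff_gcd_eq_1 gcd.commute[of x])

lemma coprime_diff_left_nat:
  fixes x y :: nat
  assumes "y < x"
  shows "coprime (x - y) y \<longleftrightarrow> coprime x y"
  using coprime_diff_right_nat[OF assms] by (simp add: coprime_commute)

text \<open>
  This is a single subtractive step of Euclid's algorithm read backwards: compare \<open>x\<close> and \<open>y\<close> and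
  subtract the smaller from the larger.
\<close>
lemma coprime_pairs_decomposition:
  "coprime_pairs = {(1, 1)} \<union> ((\<lambda>(x, y). (x, x + y)) ` coprime_pairs
                             \<union> (\<lambda>(x, y). (x + y, y)) ` coprime_pairs)"
  (is "_ = {_} \<union> (?U ` _ \<union> ?V ` _)")
proof (intro subset_antisym subsetI)
  fix p assume "p \<in> coprime_pairs"
  then obtain x y where p: "p = (x, y)" "0 < x" "0 < y" "coprime x y"
    by (auto simp: coprime_pairs_def)
  consider "x = y" | "x < y" | "y < x" by linarith
  then show "p \<in> {(1, 1)} \<union> (?U ` coprime_pairs \<union> ?V ` coprime_pairs)"
  proof cases
    case 1
    then show ?thesis using p by simp
  next
    case 2
    then have "(x, y - x) \<in> coprime_pairs" "p = ?U (x, y - x)"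
      using p by (auto simp: coprime_pairs_def coprime_diff_right_nat)
    then show ?thesis by blast
  next
    case 3
    then have "(x - y, y) \<in> coprime_pairs" "p = ?V (x - y, y)"
      using p by (auto simp: coprime_pairs_def coprime_diff_left_nat)
    then show ?thesis by blast
  qed
qed (auto simp: coprime_pairs_def coprime_iff_gcd_eq_1)

lemma sum_over_coprime_pairs:
  "((\<lambda>(x, y). 1 / (real x ^ 2 * real y ^ 2 * (real x + real y) ^ 2)) has_sum (1 / 3)) coprime_pairs"
proof -
  let ?U = "\<lambda>(x, y). (x, x + y) :: nat \<times> nat" and ?V = "\<lambda>(x, y). (x + y, y) :: nat \<times> nat"
  define u where "u = infsum F (?U ` coprime_pairs)"
  define v where "v = infsum F (?V ` coprime_pairs)"
  have u: "(F has_sum u) (?U ` coprime_pairs)" and v: "(F has_sum v) (?V ` coprime_pairs)"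
    unfolding u_def v_def by (intro has_sum_infsum F_summable)+
  have one: "(F has_sum 1) {(1, 1)}"
    using has_sum_finite[of "{(1, 1)}" F] by (simp add: F_def)
  have "?U ` coprime_pairs \<inter> ?V ` coprime_pairs = {}"
    and "{(1, 1)} \<inter> (?U ` coprime_pairs \<union> ?V ` coprime_pairs) = {}"
    by (auto simp: coprime_pairs_def)
  then have "(F has_sum (1 + (u + v))) ({(1, 1)} \<union> (?U ` coprime_pairs \<union> ?V ` coprime_pairs))"
    by (intro has_sum_Un_disjoint one u v)
  then have whole: "(F has_sum (1 + (u + v))) coprime_pairs"
    by (simp only: coprime_pairs_decomposition[symmetric])
  have "inj_on ?U coprime_pairs" "inj_on ?V coprime_pairs"
    by (auto simp: inj_on_def)
  then have u': "((F \<circ> ?U) has_sum u) coprime_pairs" and v': "((F \<circ> ?V) has_sum v) coprime_pairs"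
    using u v by (simp_all add: has_sum_reindex)
  define t :: "nat \<times> nat \<Rightarrow> real"
    where "t = (\<lambda>(x, y). 1 / (real x ^ 2 * real y ^ 2 * (real x + real y) ^ 2))"
  have telescope: "3 * t p = F p + (- (F \<circ> ?U) p + - (F \<circ> ?V) p)" if "p \<in> coprime_pairs" for p
  proof -
    obtain x y where p: "p = (x, y)" "0 < x" "0 < y"
      using \<open>p \<in> coprime_pairs\<close> by (auto simp: coprime_pairs_def)
    show ?thesis
      using inverse_cubes_identity[of "real x" "real y"] p by (simp add: F_def t_def)
  qed
  have "((\<lambda>p. F p + (- (F \<circ> ?U) p + - (F \<circ> ?V) p)) has_sum (1 + (u + v) + (- u + - v))) coprime_pairs"
    by (intro has_sum_add whole) (use u' v' in \<open>simp_all add: has_sum_uminus o_def\<close>)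
  then have "((\<lambda>p. 3 * t p) has_sum 1) coprime_pairs"
    by (subst has_sum_cong[OF telescope]) simp_all
  then have "(t has_sum (1 / 3)) coprime_pairs"
    by (subst (asm) has_sum_cmult_right_iff) auto
  then show ?thesis
    by (simp add: t_def)
qed

text \<open>
  The first row \<open>(a, b)\<close> of a matrix of determinant \<open>1\<close> with column sums \<open>x\<close>, \<open>y\<close> satisfies
  \<open>a y = b x + 1\<close> and \<open>a \<le> x\<close>, so uniqueness here makes the matrix determined by its column sums.
  Two solutions differ by a multiple of \<open>(x, y)\<close>, and \<open>a' \<le> x\<close> leaves room only for the multiple \<open>0\<close>,
  since \<open>a = 0\<close> is impossible.
\<close>
lemma bezout_bounded_unique:
  fixes a b a' b' x y :: nat
  assumes "a * y = b * x + 1" "a' * y = b' * x + 1" "a \<le> a'" "a' \<le> x" "0 < x"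
  shows "a = a' \<and> b = b'"
proof -
  have "coprime x y"
    using assms(1) by (metis coprimeI dvd_add_right_iff dvd_mult2 mult.commute)
  have "(a' - a) * y = (b' - b) * x"
    using assms(1,2) by (simp add: diff_mult_distrib)
  then have "x dvd (a' - a) * y"
    by simp
  then have "x dvd a' - a"
    using \<open>coprime x y\<close> by (simp add: coprime_dvd_mult_left_iff)
  moreover have "0 < a"
    using assms(1) by (cases a) auto
  ultimately have "a = a'"
    using assms(3-5) by (auto dest: dvd_imp_le)
  then show ?thesis
    using assms by auto
qed

text \<open>
  The same Euclidean step lifts to matrices: adding one column of a matrix to the other keeps its
  determinant and adds one column sum to the other, starting from the identity matrix for \<open>(1, 1)\<close>.
\<close>
lemma exists_matrix_with_column_sums:
  assumes "0 < x" "0 < y" "coprime x y"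
  shows "\<exists>a b c d :: nat. a * d = b * c + 1 \<and> x = a + c \<and> y = b + d"
  using assms
proof (induction "x + y" arbitrary: x y rule: less_induct)
  case less
  consider "x = y" | "x < y" | "y < x" by linarith
  then show ?case
  proof cases
    case 1
    with less.prems have "1 * 1 = 0 * (0::nat) + 1 \<and> x = 1 + 0 \<and> y = 0 + 1"
      by simp
    then show ?thesis by blast
  next
    case 2
    then have "coprime x (y - x)"
      using less.prems by (simp add: coprime_diff_right_nat)
    then obtain a b c d where "a * d = b * c + 1" "x = a + c" "y - x = b + d"
      using less.hyps[of x "y - x"] less.prems 2 by auto
    then have "a * (c + d) = (a + b) * c + 1 \<and> x = a + c \<and> y = (a + b) + (c + d)"
      using 2 by (auto simp: algebra_simps)
    then show ?thesis by blast
  next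
    case 3
    then have "coprime (x - y) y"
      using less.prems by (simp add: coprime_diff_left_nat)
    then obtain a b c d where "a * d = b * c + 1" "x - y = a + c" "y = b + d"
      using less.hyps[of "x - y" y] less.prems 3 by auto
    then have "(a + b) * d = b * (c + d) + 1 \<and> x = (a + b) + (c + d) \<and> y = b + d"
      using 3 by (auto simp: algebra_simps)
    then show ?thesis by blast
  qed
qed

lemma bij_column_sums:
  "bij_betw (\<lambda>(a, b, c, d). (a + c, b + d))
     {(a :: nat, b :: nat, c :: nat, d :: nat). int a * int d - int b * int c = 1} coprime_pairs"
  (is "bij_betw ?h ?M _")
proof -
  have det_iff: "int a * int d - int b * int c = 1 \<longleftrightarrow> a * d = b * c + 1" for a b c d
  proof -
    have "a * d = b * c + 1 \<longleftrightarrow> int (a * d) = int (b * c + 1)"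
      by (simp only: of_nat_eq_iff)
    then show ?thesis by auto
  qed
  have bezout: "a * (b + d) = b * (a + c) + 1" if "a * d = b * c + 1" for a b c d :: nat
    using that by (simp add: algebra_simps)
  have inj: "inj_on ?h ?M"
  proof (rule inj_onI)
    fix p q assume pq: "p \<in> ?M" "q \<in> ?M" "?h p = ?h q"
    obtain a b c d a' b' c' d' where [simp]: "p = (a, b, c, d)" "q = (a', b', c', d')"
      by (metis prod.exhaust)
    have det: "a * d = b * c + 1" "a' * d' = b' * c' + 1"
      and sums: "a + c = a' + c'" "b + d = b' + d'"
      using pq by (auto simp: det_iff)
    note bz = bezout[OF det(1)] bezout[OF det(2), folded sums]
    have bounds: "a \<le> a + c" "a' \<le> a + c"
      using sums by linarith+
    have "0 < a + c"
      using det by (cases a) auto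
    then have "a = a' \<and> b = b'"
      using bezout_bounded_unique[OF bz _ bounds(2)] bezout_bounded_unique[OF bz(2,1) _ bounds(1)]
      by (metis nat_le_linear)
    then show "p = q"
      using sums by simp
  qed
  have "?h p \<in> coprime_pairs" if "p \<in> ?M" for p
  proof -
    obtain a b c d where [simp]: "p = (a, b, c, d)"
      by (metis prod.exhaust)
    have det: "a * d = b * c + 1"
      using that by (simp add: det_iff)
    have "0 < a" "0 < d"
      using det by (cases a; cases d; auto)+
    moreover have "coprime (a + c) (b + d)"
      using bezout[OF det] by (metis coprimeI dvd_add_right_iff dvd_mult2 mult.commute)
    ultimately show ?thesis
      by (simp add: coprime_pairs_def)
  qed
  moreover have "q \<in> ?h ` ?M" if "q \<in> coprime_pairs" for q
  proof -
    obtain x y where q: "q = (x, y)" "0 < x" "0 < y" "coprime x y"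
      using \<open>q \<in> coprime_pairs\<close> by (auto simp: coprime_pairs_def)
    obtain a b c d where "a * d = b * c + 1" "x = a + c" "y = b + d"
      using exists_matrix_with_column_sums[OF q(2-4)] by blast
    then have "(a, b, c, d) \<in> ?M" "q = ?h (a, b, c, d)"
      using q(1) by (simp_all add: det_iff)
    then show ?thesis by (rule rev_image_eqI)
  qed
  ultimately have "?h ` ?M = coprime_pairs"
    by blast
  with inj show ?thesis
    by (simp add: bij_betw_def)
qed

theorem mainTheorem2:
  shows "((\<lambda>(a, b, c, d).
            1 / ((real a + real c)^2 * (real b + real d)^2 * (real a + real b + real c + real d)^2))
          has_sum (1 / 3))
         {(a :: nat, b :: nat, c :: nat, d :: nat). int a * int d - int b * int c = 1}"
  using sum_over_coprime_pairs[folded has_sum_reindex_bij_betw[OF bij_column_sums]]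
  by (simp add: case_prod_unfold add_ac)

end
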